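(* Let $\Gamma=(V_\Gamma,E_\Gamma)$ be a graph with vertices $v_1,\dots,v_k$, and let $T:X\to X$ be the associated GNN operator (defined in the context) on the direct sum Hilbert space $X=\bigoplus_{i=1}^k X_{v_i}$, $X_{v_i}=L_2([-1,1])$, built from a linear operator $W:L_2([-1,1])\to L_2([-1,1])$. Suppose $W$ is Lipschitz with constant $L$. Let $P(z_1,\dots,z_k)\in\mathbb Z[z_1,\dots,z_k]$ be a polynomial of degree $1$ with non-negative coefficients, depending only on $\Gamma$, such that $$\|T(f)-T(g)\|\le L\cdot P(\|f_1-g_1\|,\dots,\|f_k-g_k\|)$$ for all $f=\sum_i f_i$ and $g=\sum_i g_i$ in $X$ with $f_i,g_i\in X_{v_i}$ (the existence of such a $P$ is a preceding result of the same source). Let $\alpha:=\max_i\alpha_i$, where the $\alpha_i$ are the coefficients of $P$, and suppose that $L\alpha<1$. Then the fixed point problem $$T(y)+f=y$$ has a unique solution for any choice of $f\in X$, and the iterations $y_n$ defined by $y_0=f$, $y_{n+1}=T(y_n)+f$ converge to this solution.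
   Context: $\Gamma=(V_\Gamma,E_\Gamma)$ is a graph with vertex set $V_\Gamma=\{v_1,\dots,v_k\}$, $k=|V_\Gamma|$, and edge set $E_\Gamma$; $N(v)$ denotes the neighborhood of the vertex $v$ determined by $E_\Gamma$. To each vertex $v$ is associated a copy $X_v=L_2([-1,1])$ of the Hilbert space of square-integrable functions, and $X=\bigoplus_{v\in V_\Gamma}X_v$ is the direct sum Hilbert space; an element of $X$ is written $f=f_1+\cdots+f_k$ with $f_i\in X_{v_i}$. A single linear operator $W:L_2([-1,1])\to L_2([-1,1])$ is shared by all vertices; Lipschitz with constant $L$ means $\|Wg-Wh\|\le L\|g-h\|$ for all $g,h$. $R$ denotes the pointwise ReLU, $R(g)(t)=\max\{g(t),0\}$. The aggregation operator at $v$ is $$A_v(f)(t)=\max_i\{\,R(W(f_i))(t)\ :\ v_i\in N(v)\,\},$$ viewed as an element of $X_v$. The GNN operator $T:X\to X$ is $T(f)=\sum_i A_{v_i}(f)$, i.e. the component of $T(f)$ in $X_{v_i}$ is $A_{v_i}(f)$. *)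

theory Defs
  imports "HOL-Analysis.Analysis" "HOL-Library.Poly_Mapping"
begin

section \<open>The Hilbert space of square-integrable functions on the interval from -1 to 1\<close>

abbreviation lebI :: "real measure" where
  "lebI \<equiv> lebesgue_on {-1..1}"

definition sq_integrable :: "(real \<Rightarrow> real) \<Rightarrow> bool" where
  "sq_integrable f \<longleftrightarrow> f \<in> borel_measurable lebI \<and> integrable lebI (\<lambda>t. (f t)\<^sup>2)"

definition eq_L2 :: "(real \<Rightarrow> real) \<Rightarrow> (real \<Rightarrow> real) \<Rightarrow> bool" where
  "eq_L2 f g \<longleftrightarrow> sq_integrable f \<and> sq_integrable g \<and> (AE t in lebI. f t = g t)"

lemma sq_integrable_zero: "sq_integrable (\<lambda>t. 0)"
  by (simp add: sq_integrable_def)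

lemma sq_integrable_mult:
  assumes "sq_integrable f" "sq_integrable g"
  shows "integrable lebI (\<lambda>t. f t * g t)"
proof (rule Bochner_Integration.integrable_bound)
  show "integrable lebI (\<lambda>t. (f t)\<^sup>2 + (g t)\<^sup>2)"
    using assms by (simp add: sq_integrable_def)
  show "(\<lambda>t. f t * g t) \<in> borel_measurable lebI"
    using assms by (auto simp: sq_integrable_def intro: borel_measurable_times)
  have "\<bar>a * b\<bar> \<le> a\<^sup>2 + b\<^sup>2" for a b :: real
  proof -
    have "2 * \<bar>a\<bar> * \<bar>b\<bar> \<le> a\<^sup>2 + b\<^sup>2"
      using sum_squares_bound[of "\<bar>a\<bar>" "\<bar>b\<bar>"] by simp
    moreover have "0 \<le> \<bar>a\<bar> * \<bar>b\<bar>" by simp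
    ultimately show ?thesis unfolding abs_mult by linarith
  qed
  then show "AE t in lebI. norm (f t * g t) \<le> norm ((f t)\<^sup>2 + (g t)\<^sup>2)"
    by (intro AE_I2) auto
qed

lemma sq_integrable_add:
  assumes "sq_integrable f" "sq_integrable g"
  shows "sq_integrable (\<lambda>t. f t + g t)"
  using assms sq_integrable_mult[OF assms]
  by (auto simp: sq_integrable_def power2_sum mult.assoc intro: borel_measurable_add)

lemma sq_integrable_scale:
  assumes "sq_integrable f"
  shows "sq_integrable (\<lambda>t. c * f t)"
  using assms
  by (auto simp: sq_integrable_def power_mult_distrib intro: borel_measurable_times)

lemma sq_integrable_max:
  assumes "sq_integrable f" "sq_integrable g"
  shows "sq_integrable (\<lambda>t. max (f t) (g t))"
  unfolding sq_integrable_def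
proof
  show meas: "(\<lambda>t. max (f t) (g t)) \<in> borel_measurable lebI"
    using assms by (auto simp: sq_integrable_def intro: borel_measurable_max)
  show "integrable lebI (\<lambda>t. (max (f t) (g t))\<^sup>2)"
  proof (rule Bochner_Integration.integrable_bound)
    show "integrable lebI (\<lambda>t. (f t)\<^sup>2 + (g t)\<^sup>2)"
      using assms by (simp add: sq_integrable_def)
    show "(\<lambda>t. (max (f t) (g t))\<^sup>2) \<in> borel_measurable lebI"
      using meas by simp
    show "AE t in lebI. norm ((max (f t) (g t))\<^sup>2) \<le> norm ((f t)\<^sup>2 + (g t)\<^sup>2)"
      by (intro AE_I2) (auto simp: max_def)
  qed
qed

lemma sq_integrable_Max:
  assumes "finite S" "S \<noteq> {}" "\<And>i. i \<in> S \<Longrightarrow> sq_integrable (f i)"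
  shows "sq_integrable (\<lambda>t. Max ((\<lambda>i. f i t) ` S))"
  using assms
  by (induction S rule: finite_ne_induct) (auto simp: sq_integrable_max)

quotient_type L2 = "real \<Rightarrow> real" / partial: eq_L2
proof (rule part_equivpI)
  show "\<exists>f. eq_L2 f f"
    using sq_integrable_zero by (auto simp: eq_L2_def)
  show "symp eq_L2"
    by (rule sympI) (auto simp: eq_L2_def)
  show "transp eq_L2"
    by (rule transpI) (auto simp: eq_L2_def elim!: AE_mp)
qed

instantiation L2 :: real_vector
begin

lift_definition zero_L2 :: L2 is "\<lambda>t. 0"
  by (simp add: eq_L2_def sq_integrable_zero)

lift_definition plus_L2 :: "L2 \<Rightarrow> L2 \<Rightarrow> L2" is "\<lambda>f g t. f t + g t"
  by (auto simp: eq_L2_def sq_integrable_add)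

lift_definition scaleR_L2 :: "real \<Rightarrow> L2 \<Rightarrow> L2" is "\<lambda>c f t. c * f t"
  by (auto simp: eq_L2_def sq_integrable_scale)

definition uminus_L2 :: "L2 \<Rightarrow> L2" where "uminus_L2 f = (-1) *\<^sub>R f"

definition minus_L2 :: "L2 \<Rightarrow> L2 \<Rightarrow> L2" where "minus_L2 f g = f + (-1) *\<^sub>R g"

instance
proof
  fix a b c :: L2 and r s :: real
  show "a + b + c = a + (b + c)"
    by transfer (auto simp: eq_L2_def sq_integrable_add add.assoc)
  show "a + b = b + a"
    by transfer (auto simp: eq_L2_def sq_integrable_add add.commute)
  show "0 + a = a"
    by transfer (auto simp: eq_L2_def)
  show "- a + a = 0"
    unfolding uminus_L2_def
    by transfer (auto simp: eq_L2_def sq_integrable_zero)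
  show "a - b = a + - b"
    by (simp add: uminus_L2_def minus_L2_def)
  show "r *\<^sub>R (a + b) = r *\<^sub>R a + r *\<^sub>R b"
    by transfer (auto simp: eq_L2_def sq_integrable_add sq_integrable_scale distrib_left)
  show "(r + s) *\<^sub>R a = r *\<^sub>R a + s *\<^sub>R a"
    by transfer (auto simp: eq_L2_def sq_integrable_add sq_integrable_scale distrib_right)
  show "r *\<^sub>R s *\<^sub>R a = (r * s) *\<^sub>R a"
    by transfer (auto simp: eq_L2_def sq_integrable_scale mult.assoc)
  show "1 *\<^sub>R a = a"
    by transfer (auto simp: eq_L2_def)
qed

end

instantiation L2 :: real_inner
begin

lift_definition inner_L2 :: "L2 \<Rightarrow> L2 \<Rightarrow> real" is "\<lambda>f g. \<integral>t. f t * g t \<partial>lebI"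
  by (intro integral_cong_AE) (auto simp: eq_L2_def sq_integrable_def)

definition norm_L2 :: "L2 \<Rightarrow> real" where "norm_L2 f = sqrt (inner f f)"

definition sgn_L2 :: "L2 \<Rightarrow> L2" where "sgn_L2 f = f /\<^sub>R norm f"

definition dist_L2 :: "L2 \<Rightarrow> L2 \<Rightarrow> real" where "dist_L2 f g = norm (f - g)"

definition uniformity_L2 :: "(L2 \<times> L2) filter" where
  "uniformity_L2 = (INF e\<in>{0<..}. principal {(f, g). dist f g < e})"

definition open_L2 :: "L2 set \<Rightarrow> bool" where
  "open_L2 U \<longleftrightarrow> (\<forall>f\<in>U. \<forall>\<^sub>F (f', g) in uniformity. f' = f \<longrightarrow> g \<in> U)"

instance
proof
  fix a b c :: L2 and r :: real and U :: "L2 set"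
  show "inner a b = inner b a"
    by transfer (simp add: mult.commute)
  show "inner (a + b) c = inner a c + inner b c"
    by transfer (simp add: eq_L2_def distrib_right sq_integrable_mult)
  show "inner (r *\<^sub>R a) b = r * inner a b"
    by transfer (simp add: mult.assoc)
  show "0 \<le> inner a a"
    by transfer simp
  show "inner a a = 0 \<longleftrightarrow> a = 0"
  proof transfer
    fix f assume f: "eq_L2 f f"
    then have sq: "sq_integrable f" by (simp add: eq_L2_def)
    have "(\<integral>t. f t * f t \<partial>lebI) = 0 \<longleftrightarrow> (AE t in lebI. f t * f t = 0)"
      by (rule integral_nonneg_eq_0_iff_AE) (auto intro: sq_integrable_mult sq)
    then show "(\<integral>t. f t * f t \<partial>lebI) = 0 \<longleftrightarrow> eq_L2 f (\<lambda>t. 0)"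
      by (simp add: eq_L2_def sq sq_integrable_zero)
  qed
qed (fact norm_L2_def sgn_L2_def dist_L2_def uniformity_L2_def open_L2_def)+

end

section \<open>Graphs and the GNN operator\<close>

text \<open>
  The vertices are the elements of a finite type, and the edge set consists of unordered pairs.
  Loops are not excluded.
\<close>

definition is_graph :: "'v set set \<Rightarrow> bool" where
  "is_graph E \<longleftrightarrow> (\<forall>e\<in>E. \<exists>u v. e = {u, v})"

definition nbhd :: "'v set set \<Rightarrow> 'v \<Rightarrow> 'v set" where
  "nbhd E v = {u. {u, v} \<in> E}"

lift_definition relu :: "L2 \<Rightarrow> L2" is "\<lambda>g t. max (g t) 0"
  by (auto simp: eq_L2_def sq_integrable_max sq_integrable_zero)

text \<open>The maximum over an empty neighbourhood is taken to be the zero function.\<close>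

lift_definition max_L2 :: "'v::finite set \<Rightarrow> ('v \<Rightarrow> L2) \<Rightarrow> L2" is
  "\<lambda>S g t. if S = {} then 0 else Max ((\<lambda>i. g i t) ` S)"
proof -
  fix S :: "'v set" and g h :: "'v \<Rightarrow> real \<Rightarrow> real"
  assume gh: "\<And>i. eq_L2 (g i) (h i)"
  then have "AE t in lebI. \<forall>i\<in>S. g i t = h i t"
    by (intro AE_finite_allI) (auto simp: eq_L2_def)
  then have "AE t in lebI. (\<lambda>i. g i t) ` S = (\<lambda>i. h i t) ` S"
    by eventually_elim (auto intro!: image_cong)
  then have "AE t in lebI. Max ((\<lambda>i. g i t) ` S) = Max ((\<lambda>i. h i t) ` S)"
    by eventually_elim simp
  then show "eq_L2 (\<lambda>t. if S = {} then 0 else Max ((\<lambda>i. g i t) ` S))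
                (\<lambda>t. if S = {} then 0 else Max ((\<lambda>i. h i t) ` S))"
    using gh by (cases "S = {}") (auto simp: eq_L2_def sq_integrable_zero sq_integrable_Max)
qed

text \<open>
  The Hilbert direct sum of one copy of \<^typ>\<open>L2\<close> per vertex is \<^typ>\<open>L2 ^ 'v\<close>: the library norm
  of a vector is the square root of the sum of the squared norms of its components.
\<close>

definition aggregate :: "'v::finite set set \<Rightarrow> (L2 \<Rightarrow> L2) \<Rightarrow> 'v \<Rightarrow> L2 ^ 'v \<Rightarrow> L2" where
  "aggregate E W v f = max_L2 (nbhd E v) (\<lambda>i. relu (W (f $ i)))"

definition gnn :: "'v::finite set set \<Rightarrow> (L2 \<Rightarrow> L2) \<Rightarrow> L2 ^ 'v \<Rightarrow> L2 ^ 'v" where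
  "gnn E W f = (\<chi> v. aggregate E W v f)"

section \<open>Integer polynomials with one variable per vertex\<close>

text \<open>
  A monomial is its finitely supported exponent function, a polynomial the finitely supported
  function giving the coefficient of each monomial.
\<close>

type_synonym 'v int_mpoly = "('v \<Rightarrow>\<^sub>0 nat) \<Rightarrow>\<^sub>0 int"

definition total_degree :: "'v int_mpoly \<Rightarrow> nat" where
  "total_degree P =
    Max (insert 0 ((\<lambda>m. \<Sum>i\<in>Poly_Mapping.keys m. Poly_Mapping.lookup m i) ` Poly_Mapping.keys P))"

definition mpoly_eval :: "'v int_mpoly \<Rightarrow> ('v \<Rightarrow> real) \<Rightarrow> real" where
  "mpoly_eval P z =
    (\<Sum>m\<in>Poly_Mapping.keys P. real_of_int (Poly_Mapping.lookup P m) *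
      (\<Prod>i\<in>Poly_Mapping.keys m. z i ^ Poly_Mapping.lookup m i))"

definition linear_coeff :: "'v int_mpoly \<Rightarrow> 'v \<Rightarrow> int" where
  "linear_coeff P i = Poly_Mapping.lookup P (Poly_Mapping.single i 1)"

end

theory Submission
  imports Defs
begin

text \<open>
  The operator is a contraction with constant L times the maximal linear coefficient, already for the
  Hilbert norm. Evaluating the assumed bound on two vectors supported at the single vertex i shows,
  after removing the constant term by positive homogeneity, that
  sqrt (deg i) * norm (R (W x) - R (W y)) is at most L * alpha_i * norm (x - y). Conversely, the
  square of a difference of maxima is at most the sum of the squared differences, so the squared
  norm of T g - T h is at most the sum over i of deg i * norm (R (W g_i) - R (W h_i))^2. The degrees
  cancel, and no dimension-dependent constant from comparing the sum norm with the Hilbert norm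
  appears. The rest is Banach's fixed point theorem and the completeness of L2.
\<close>

section \<open>Completeness of L2\<close>

lemma abs_rep_L2: "abs_L2 (rep_L2 x) = x"
  by (rule Quotient_abs_rep[OF Quotient_L2])

lemma sq_integrable_rep_L2: "sq_integrable (rep_L2 x)"
  using Quotient_rep_reflp[OF Quotient_L2, of x] by (simp add: eq_L2_def)

lemma eq_L2_refl: "eq_L2 f f \<longleftrightarrow> sq_integrable f"
  by (auto simp: eq_L2_def)

lemma sq_integrable_diff:
  assumes "sq_integrable f" "sq_integrable g"
  shows "sq_integrable (\<lambda>t. f t - g t)"
  using sq_integrable_add[OF assms(1) sq_integrable_scale[OF assms(2), of "-1"]] by simp

lemma abs_L2_diff:
  assumes "sq_integrable f" "sq_integrable g"
  shows "abs_L2 f - abs_L2 g = abs_L2 (\<lambda>t. f t - g t)"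
proof -
  have "abs_L2 f - abs_L2 g = abs_L2 f + abs_L2 (\<lambda>t. - 1 * g t)"
    using assms by (simp only: minus_L2_def scaleR_L2.abs_eq eq_L2_refl)
  also have "\<dots> = abs_L2 (\<lambda>t. f t + - 1 * g t)"
    using assms by (intro plus_L2.abs_eq) (simp_all only: eq_L2_refl sq_integrable_scale)
  finally show ?thesis
    by simp
qed

lemma norm_abs_L2:
  assumes "sq_integrable f"
  shows "(norm (abs_L2 f))\<^sup>2 = (\<integral>t. (f t)\<^sup>2 \<partial>lebI)"
  unfolding power2_norm_eq_inner using assms
  by (simp add: inner_L2.abs_eq eq_L2_refl power2_eq_square)

lemma norm_abs_L2_diff:
  assumes "sq_integrable f" "sq_integrable g"
  shows "(norm (abs_L2 f - abs_L2 g))\<^sup>2 = (\<integral>t. (f t - g t)\<^sup>2 \<partial>lebI)"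
  using assms by (simp add: abs_L2_diff norm_abs_L2 sq_integrable_diff)

text \<open>Cauchy-Schwarz against the constant function 1, whose norm is \<open>sqrt 2\<close>
  because the interval has length 2. It lets convergence in \<open>L2\<close> control integrals of
  absolute values.\<close>

lemma integral_abs_le_norm_L2:
  assumes "sq_integrable f"
  shows "integrable lebI (\<lambda>t. \<bar>f t\<bar>)" and "(\<integral>t. \<bar>f t\<bar> \<partial>lebI) \<le> sqrt 2 * norm (abs_L2 f)"
proof -
  have one: "sq_integrable (\<lambda>t. 1)"
    by (simp add: sq_integrable_def)
  have abs: "sq_integrable (\<lambda>t. \<bar>f t\<bar>)"
    using assms by (auto simp: sq_integrable_def)
  show "integrable lebI (\<lambda>t. \<bar>f t\<bar>)"
    using sq_integrable_mult[OF abs one] by simp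
  have "(norm (abs_L2 (\<lambda>t. 1)))\<^sup>2 = 2"
    using norm_abs_L2[OF one] by (simp add: measure_restrict_space)
  then have n1: "norm (abs_L2 (\<lambda>t. 1)) = sqrt 2"
    by (metis norm_ge_zero real_sqrt_unique)
  have "(norm (abs_L2 (\<lambda>t. \<bar>f t\<bar>)))\<^sup>2 = (norm (abs_L2 f))\<^sup>2"
    using norm_abs_L2[OF abs] norm_abs_L2[OF assms] by simp
  then have n2: "norm (abs_L2 (\<lambda>t. \<bar>f t\<bar>)) = norm (abs_L2 f)"
    by simp
  have "(\<integral>t. \<bar>f t\<bar> \<partial>lebI) = inner (abs_L2 (\<lambda>t. \<bar>f t\<bar>)) (abs_L2 (\<lambda>t. 1))"
    using abs one by (simp add: inner_L2.abs_eq eq_L2_refl)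
  also have "\<dots> \<le> norm (abs_L2 (\<lambda>t. \<bar>f t\<bar>)) * norm (abs_L2 (\<lambda>t. 1))"
    by (rule norm_cauchy_schwarz)
  finally show "(\<integral>t. \<bar>f t\<bar> \<partial>lebI) \<le> sqrt 2 * norm (abs_L2 f)"
    by (simp add: n1 n2 mult.commute)
qed

text \<open>The absolute increments have summable integrals, so their pointwise sum has a finite
  integral and is finite almost everywhere. Where it is finite, the increments telescope to a
  convergent sequence.\<close>

lemma AE_convergent_L2:
  assumes sq: "\<And>n. sq_integrable (G n)"
    and fast: "\<And>n. norm (abs_L2 (G (Suc n)) - abs_L2 (G n)) \<le> (1/2) ^ n"
  shows "AE t in lebI. convergent (\<lambda>n. G n t)"
proof -
  define d where "d n t = \<bar>G (Suc n) t - G n t\<bar>" for n t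
  have meas: "G n \<in> borel_measurable lebI" for n
    using sq by (simp add: sq_integrable_def)
  have dm[measurable]: "(\<lambda>t. d n t) \<in> borel_measurable lebI" for n
    unfolding d_def using meas by (intro borel_measurable_abs borel_measurable_diff) 
  have bnd: "(\<integral>\<^sup>+t. ennreal (d n t) \<partial>lebI) \<le> ennreal (sqrt 2 * (1/2) ^ n)" for n
  proof -
    note D = sq_integrable_diff[OF sq[of "Suc n"] sq[of n]]
    have "(\<integral>\<^sup>+t. ennreal (d n t) \<partial>lebI) = ennreal (\<integral>t. d n t \<partial>lebI)"
      unfolding d_def using integral_abs_le_norm_L2(1)[OF D] by (intro nn_integral_eq_integral) auto
    also have "(\<integral>t. d n t \<partial>lebI) \<le> sqrt 2 * norm (abs_L2 (G (Suc n)) - abs_L2 (G n))"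
      unfolding d_def using integral_abs_le_norm_L2(2)[OF D] by (simp add: abs_L2_diff sq)
    also have "\<dots> \<le> sqrt 2 * (1/2) ^ n"
      using fast[of n] by (intro mult_left_mono) auto
    finally show ?thesis
      by (simp add: ennreal_leI)
  qed
  have summ: "summable (\<lambda>n. sqrt 2 * (1/2) ^ n)"
    by (intro summable_mult summable_geometric) simp
  have "(\<integral>\<^sup>+t. suminf (\<lambda>n. ennreal (d n t)) \<partial>lebI) = suminf (\<lambda>n. \<integral>\<^sup>+t. ennreal (d n t) \<partial>lebI)"
    by (rule nn_integral_suminf) simp
  also have "\<dots> \<le> suminf (\<lambda>n. ennreal (sqrt 2 * (1/2) ^ n))"
    using bnd by (intro suminf_le) auto
  also have "\<dots> = ennreal (suminf (\<lambda>n. sqrt 2 * (1/2) ^ n))"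
    using summ by (intro suminf_ennreal2) auto
  finally have "(\<integral>\<^sup>+t. suminf (\<lambda>n. ennreal (d n t)) \<partial>lebI) \<noteq> \<infinity>"
    by (auto simp: top_unique)
  then have "AE t in lebI. suminf (\<lambda>n. ennreal (d n t)) \<noteq> \<infinity>"
    by (intro nn_integral_PInf_AE) auto
  then show ?thesis
  proof eventually_elim
    case (elim t)
    then have "summable (\<lambda>n. d n t)"
      by (intro summable_suminf_not_top) (auto simp: d_def)
    then have "summable (\<lambda>n. G (Suc n) t - G n t)"
      unfolding d_def by (rule summable_rabs_cancel)
    then have "convergent (\<lambda>n. \<Sum>k<n. G (Suc k) t - G k t)"
      by (simp add: summable_iff_convergent)
    then have "convergent (\<lambda>n. G n t - G 0 t)"
      by (simp add: sum_lessThan_telescope[of "\<lambda>n. G n t"])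
    then show ?case
      by (simp add: convergent_diff_const_right_iff)
  qed
qed

text \<open>Fatou's lemma for the squares of \<open>G k - h\<close>. With \<open>h\<close> a late
  member of the sequence, it turns almost everywhere convergence of a Cauchy sequence into
  convergence in norm.\<close>

lemma Fatou_L2:
  assumes G: "\<And>k. sq_integrable (G k)" and h: "sq_integrable h"
    and g: "g \<in> borel_measurable lebI"
    and lim: "AE t in lebI. (\<lambda>k. G k t) \<longlonglongrightarrow> g t"
    and e: "e \<ge> 0" and bnd: "eventually (\<lambda>k. norm (abs_L2 (G k) - abs_L2 h) \<le> e) sequentially"
  shows "sq_integrable g" and "norm (abs_L2 g - abs_L2 h) \<le> e"
proof -
  have meas: "G k \<in> borel_measurable lebI" "h \<in> borel_measurable lebI" for k
    using G h by (auto simp: sq_integrable_def)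
  note [measurable] = meas g
  have "(\<integral>\<^sup>+t. ennreal ((g t - h t)\<^sup>2) \<partial>lebI) =
      (\<integral>\<^sup>+t. liminf (\<lambda>k. ennreal ((G k t - h t)\<^sup>2)) \<partial>lebI)"
  proof (rule nn_integral_cong_AE)
    show "AE t in lebI. ennreal ((g t - h t)\<^sup>2) = liminf (\<lambda>k. ennreal ((G k t - h t)\<^sup>2))"
      using lim
    proof eventually_elim
      case (elim t)
      then have "(\<lambda>k. ennreal ((G k t - h t)\<^sup>2)) \<longlonglongrightarrow> ennreal ((g t - h t)\<^sup>2)"
        by (intro tendsto_intros)
      then show ?case
        by (rule lim_imp_Liminf[OF sequentially_bot, symmetric])
    qed
  qed
  also have "\<dots> \<le> liminf (\<lambda>k. \<integral>\<^sup>+t. ennreal ((G k t - h t)\<^sup>2) \<partial>lebI)"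
    by (rule nn_integral_liminf) measurable
  also have "\<dots> \<le> liminf (\<lambda>k. ennreal (e\<^sup>2))"
  proof (rule Liminf_mono)
    show "\<forall>\<^sub>F k in sequentially. (\<integral>\<^sup>+t. ennreal ((G k t - h t)\<^sup>2) \<partial>lebI) \<le> ennreal (e\<^sup>2)"
      using bnd
    proof eventually_elim
      case (elim k)
      have "(\<integral>\<^sup>+t. ennreal ((G k t - h t)\<^sup>2) \<partial>lebI) = ennreal (\<integral>t. (G k t - h t)\<^sup>2 \<partial>lebI)"
        using sq_integrable_diff[OF G h] by (intro nn_integral_eq_integral) (auto simp: sq_integrable_def)
      also have "\<dots> \<le> ennreal (e\<^sup>2)"
        using elim by (simp add: norm_abs_L2_diff[OF G h, symmetric] ennreal_leI power_mono)
      finally show ?case .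
    qed
  qed
  also have "\<dots> = ennreal (e\<^sup>2)"
    by (simp add: Liminf_const)
  finally have le: "(\<integral>\<^sup>+t. ennreal ((g t - h t)\<^sup>2) \<partial>lebI) \<le> ennreal (e\<^sup>2)" .
  then have int: "integrable lebI (\<lambda>t. (g t - h t)\<^sup>2)"
    by (intro integrableI_bounded) (auto simp: le_less_trans)
  then have "sq_integrable (\<lambda>t. g t - h t)"
    by (simp add: sq_integrable_def)
  \<comment> \<open>Only the difference is known to be square-integrable so far; \<open>g\<close> is
    recovered as \<open>(g - h) + h\<close>.\<close>
  from sq_integrable_add[OF this h] show sqg: "sq_integrable g"
    by simp
  have "ennreal ((norm (abs_L2 g - abs_L2 h))\<^sup>2) \<le> ennreal (e\<^sup>2)"
    using le int by (simp add: norm_abs_L2_diff[OF sqg h] nn_integral_eq_integral)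
  then have "(norm (abs_L2 g - abs_L2 h))\<^sup>2 \<le> e\<^sup>2"
    by simp
  then show "norm (abs_L2 g - abs_L2 h) \<le> e"
    using e by (rule power2_le_imp_le)
qed

lemma Cauchy_fast_subseq:
  fixes X :: "nat \<Rightarrow> 'a::metric_space"
  assumes "Cauchy X"
  obtains r where "strict_mono r" "\<And>n. dist (X (r (Suc n))) (X (r n)) \<le> (1/2) ^ n"
proof -
  have "\<forall>n. \<exists>M. \<forall>i\<ge>M. \<forall>j\<ge>M. dist (X i) (X j) < (1/2) ^ n"
    using assms by (simp add: Cauchy_def)
  then obtain M where M: "\<And>n i j. i \<ge> M n \<Longrightarrow> j \<ge> M n \<Longrightarrow> dist (X i) (X j) < (1/2) ^ n"
    by metis
  \<comment> \<open>\<open>Suc s\<close> makes the indices strictly increase;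
    \<open>M (Suc n)\<close> keeps each index past the threshold of its own tolerance.\<close>
  define r where "r = rec_nat (M 0) (\<lambda>n s. max (Suc s) (M (Suc n)))"
  have suc: "r (Suc n) = max (Suc (r n)) (M (Suc n))" for n
    by (simp add: r_def)
  have mono: "strict_mono r"
    by (rule strict_monoI_Suc) (simp add: suc)
  have ge: "r n \<ge> M n" for n
    by (cases n) (simp_all add: r_def)
  have "dist (X (r (Suc n))) (X (r n)) \<le> (1/2) ^ n" for n
    using ge[of n] by (intro less_imp_le[OF M]) (simp_all add: suc)
  with mono show ?thesis
    by (rule that)
qed

text \<open>Riesz-Fischer: a fast subsequence converges almost everywhere, Fatou makes this
  convergence in norm, and a Cauchy sequence with a convergent subsequence converges.\<close>

instance L2 :: complete_space
proof
  fix X :: "nat \<Rightarrow> L2"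
  assume X: "Cauchy X"
  obtain r where r: "strict_mono r"
    and fast: "\<And>n. dist (X (r (Suc n))) (X (r n)) \<le> (1/2) ^ n"
    using Cauchy_fast_subseq[OF X] by blast
  define G where "G n = rep_L2 (X (r n))" for n
  have G: "sq_integrable (G n)" "abs_L2 (G n) = X (r n)" for n
    by (simp_all add: G_def sq_integrable_rep_L2 abs_rep_L2)
  \<comment> \<open>Outside the convergence set, which has a null complement, the value of
    \<open>lim\<close> is unspecified, but \<open>g\<close> is measurable all the same.\<close>
  define g where "g t = lim (\<lambda>n. G n t)" for t
  have lim: "AE t in lebI. (\<lambda>n. G n t) \<longlonglongrightarrow> g t"
    using AE_convergent_L2[of G] fast G by (auto simp: g_def convergent_LIMSEQ_iff dist_norm)
  have gm: "g \<in> borel_measurable lebI"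
    unfolding g_def using G by (intro borel_measurable_lim_metric) (simp add: sq_integrable_def)
  have "(X \<circ> r) \<longlonglongrightarrow> abs_L2 g"
  proof (rule metric_LIMSEQ_I)
    fix e :: real
    assume e: "e > 0"
    have "Cauchy (X \<circ> r)"
      using X r by (rule Cauchy_subseq_Cauchy)
    with e obtain N where N: "\<And>m n. m \<ge> N \<Longrightarrow> n \<ge> N \<Longrightarrow> dist (X (r m)) (X (r n)) < e / 2"
      unfolding Cauchy_def by (metis comp_apply half_gt_zero)
    have "dist ((X \<circ> r) n) (abs_L2 g) < e" if "n \<ge> N" for n
    proof -
      \<comment> \<open>Fatou preserves only a weak inequality, so \<open>e / 2\<close> is used to
        end strictly below \<open>e\<close>.\<close>
      have "eventually (\<lambda>k. norm (abs_L2 (G k) - abs_L2 (G n)) \<le> e / 2) sequentially"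
        using N[OF _ that] by (auto simp: eventually_sequentially G dist_norm intro!: exI[of _ N] less_imp_le)
      from Fatou_L2(2)[OF G(1) G(1) gm lim _ this] show ?thesis
        using e by (simp add: G dist_norm norm_minus_commute)
    qed
    then show "\<exists>no. \<forall>n\<ge>no. dist ((X \<circ> r) n) (abs_L2 g) < e"
      by blast
  qed
  with X r have "X \<longlonglongrightarrow> abs_L2 g"
    by (rule Cauchy_converges_subseq)
  then show "convergent X"
    by (rule convergentI)
qed


section \<open>Maxima and ReLU in L2\<close>

text \<open>At an index attaining the larger maximum, the two entries differ by at least as much as
  the maxima do. That single square is one term of the sum.\<close>

lemma Max_diff_square_le:
  fixes a b :: "'i \<Rightarrow> real"
  assumes "finite S" "S \<noteq> {}"
  shows "(Max (a ` S) - Max (b ` S))\<^sup>2 \<le> (\<Sum>i\<in>S. (a i - b i)\<^sup>2)"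
proof -
  have le: "\<exists>k\<in>S. Max (a ` S) - Max (b ` S) \<le> a k - b k" for a b :: "'i \<Rightarrow> real"
  proof -
    have "Max (a ` S) \<in> a ` S"
      using assms by (intro Max_in) auto
    then obtain k where k: "k \<in> S" "Max (a ` S) = a k"
      by auto
    moreover have "b k \<le> Max (b ` S)"
      using assms k by (intro Max_ge) auto
    ultimately show ?thesis
      by (auto intro!: bexI[of _ k])
  qed
  have "\<exists>k\<in>S. \<bar>Max (a ` S) - Max (b ` S)\<bar> \<le> \<bar>a k - b k\<bar>"
    using le[of a b] le[of b a] by (cases "Max (a ` S) \<ge> Max (b ` S)") (force+)
  then obtain k where k: "k \<in> S" "\<bar>Max (a ` S) - Max (b ` S)\<bar> \<le> \<bar>a k - b k\<bar>"
    by blast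
  have "(Max (a ` S) - Max (b ` S))\<^sup>2 \<le> (a k - b k)\<^sup>2"
    using k by (simp add: abs_le_square_iff)
  also have "\<dots> \<le> (\<Sum>i\<in>S. (a i - b i)\<^sup>2)"
    using assms k by (intro member_le_sum) auto
  finally show ?thesis .
qed

text \<open>The family is a function into \<open>L2\<close>, so the transfer rule is instantiated by
  hand, relating \<open>F\<close> to its family of classes.\<close>

lemma max_L2_abs_L2:
  fixes S :: "'v::finite set"
  assumes "\<And>i. sq_integrable (F i)" "S \<noteq> {}"
  shows "max_L2 S (\<lambda>i. abs_L2 (F i)) = abs_L2 (\<lambda>t. Max ((\<lambda>i. F i t) ` S))"
proof -
  have "rel_fun (=) pcr_L2 F (\<lambda>i. abs_L2 (F i))"
    using assms by (auto simp: rel_fun_def L2.pcr_cr_eq cr_L2_def eq_L2_refl)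
  from rel_funD[OF rel_funD[OF max_L2.transfer refl], OF this, of S] show ?thesis
    using assms(2) by (simp add: L2.pcr_cr_eq cr_L2_def)
qed

lemma max_L2_empty: "max_L2 {} f = 0"
  by transfer (simp add: eq_L2_refl sq_integrable_zero)

text \<open>The pointwise estimate for maxima is integrated over chosen representatives. Having a
  sum on the right makes the later counting over vertices possible.\<close>

lemma norm_max_L2_diff_le:
  fixes S :: "'v::finite set" and f g :: "'v \<Rightarrow> L2"
  shows "(norm (max_L2 S f - max_L2 S g))\<^sup>2 \<le> (\<Sum>i\<in>S. (norm (f i - g i))\<^sup>2)"
proof (cases "S = {}")
  case True
  then show ?thesis
    by (simp add: max_L2_empty)
next
  case False
  define F G where "F i = rep_L2 (f i)" and "G i = rep_L2 (g i)" for i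
  have sq: "sq_integrable (F i)" "sq_integrable (G i)" for i
    by (simp_all add: F_def G_def sq_integrable_rep_L2)
  have FG: "f i = abs_L2 (F i)" "g i = abs_L2 (G i)" for i
    by (simp_all add: F_def G_def abs_rep_L2)
  have sqM: "sq_integrable (\<lambda>t. Max ((\<lambda>i. F i t) ` S))" "sq_integrable (\<lambda>t. Max ((\<lambda>i. G i t) ` S))"
    using sq False by (auto intro: sq_integrable_Max)
  have int: "integrable lebI (\<lambda>t. (F i t - G i t)\<^sup>2)" for i
    using sq_integrable_diff[OF sq] by (simp add: sq_integrable_def)
  have "(norm (max_L2 S f - max_L2 S g))\<^sup>2 =
      (\<integral>t. (Max ((\<lambda>i. F i t) ` S) - Max ((\<lambda>i. G i t) ` S))\<^sup>2 \<partial>lebI)"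
    unfolding FG by (simp only: max_L2_abs_L2 sq False norm_abs_L2_diff sqM not_False_eq_True)
  also have "\<dots> \<le> (\<integral>t. (\<Sum>i\<in>S. (F i t - G i t)\<^sup>2) \<partial>lebI)"
    using int sq_integrable_diff[OF sqM] False
    by (intro integral_mono Max_diff_square_le Bochner_Integration.integrable_sum)
       (auto simp: sq_integrable_def)
  also have "\<dots> = (\<Sum>i\<in>S. (norm (f i - g i))\<^sup>2)"
    using int by (simp add: Bochner_Integration.integral_sum FG norm_abs_L2_diff sq)
  finally show ?thesis .
qed

section \<open>ReLU and its behaviour on a single nonzero entry\<close>

lemma relu_zero: "relu 0 = 0"
  by transfer (simp add: eq_L2_refl sq_integrable_zero)

lemma relu_scaleR:
  assumes "c \<ge> 0"
  shows "relu (c *\<^sub>R x) = c *\<^sub>R relu x"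
  using assms
proof transfer
  fix c :: real and g
  assume c: "c \<ge> 0" and g: "eq_L2 g g"
  have "max (c * g t) 0 = c * max (g t) 0" for t
    using c by (simp add: max_mult_distrib_left)
  then show "eq_L2 (\<lambda>t. max (c * g t) 0) (\<lambda>t. c * max (g t) 0)"
    using g by (simp add: eq_L2_refl sq_integrable_scale sq_integrable_max sq_integrable_zero)
qed

text \<open>A ReLU is nonnegative, so it survives a maximum with zeros. This computes the
  aggregation of a vector supported at one vertex; the zero default for an empty set fits the same
  formula.\<close>

lemma max_L2_single_relu:
  fixes S :: "'v::finite set"
  shows "max_L2 S (\<lambda>j. if j = i then relu x else 0) = (if i \<in> S then relu x else 0)"
proof (cases "S = {}")
  case True
  then have "max_L2 S (\<lambda>j. if j = i then relu x else 0) = 0"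
    by (simp add: max_L2_empty)
  with True show ?thesis
    by simp
next
  case False
  \<comment> \<open>This representative of \<open>relu x\<close> is nonnegative at every point, not
    just almost everywhere, so the maximum can be computed pointwise.\<close>
  define F where "F j t = (if j = i then max (rep_L2 x t) 0 else 0)" for j t
  have F: "F i = (\<lambda>t. max (rep_L2 x t) 0)" "\<And>j. j \<noteq> i \<Longrightarrow> F j = (\<lambda>t. 0)"
    by (auto simp: F_def)
  have sq: "sq_integrable (F j)" for j
    by (cases "j = i") (simp_all add: F sq_integrable_max sq_integrable_zero sq_integrable_rep_L2)
  have relu: "abs_L2 (F i) = relu x"
    using relu.abs_eq[of "rep_L2 x"] by (simp add: F eq_L2_refl sq_integrable_rep_L2 abs_rep_L2)
  have zero: "abs_L2 (F j) = 0" if "j \<noteq> i" for j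
    using that by (simp add: F zero_L2.abs_eq)
  have Max: "Max ((\<lambda>j. F j t) ` S) = (if i \<in> S then F i t else 0)" for t
  proof (rule Max_eqI)
    show "(if i \<in> S then F i t else 0) \<in> (\<lambda>j. F j t) ` S"
      using False by (force simp: F_def)
  qed (auto simp: F_def)
  have "(\<lambda>j. if j = i then relu x else 0) = (\<lambda>j. abs_L2 (F j))"
    using relu zero by auto
  then have "max_L2 S (\<lambda>j. if j = i then relu x else 0) = abs_L2 (\<lambda>t. if i \<in> S then F i t else 0)"
    using False by (simp add: max_L2_abs_L2 sq Max)
  then show ?thesis
    using relu by (simp add: zero_L2.abs_eq)
qed

section \<open>The Lipschitz constant of the GNN operator\<close>

text \<open>Dividing by \<open>s\<close> and letting it grow removes \<open>c\<close>; this is how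
  the constant term of the polynomial disappears.\<close>

lemma le_of_scaled_le:
  fixes a b c :: real
  assumes "\<And>s. s > 0 \<Longrightarrow> s * a \<le> c + s * b"
  shows "a \<le> b"
proof (rule ccontr)
  assume "\<not> a \<le> b"
  then have ab: "a - b > 0"
    by simp
  \<comment> \<open>Chosen so that \<open>s * (a - b)\<close> equals
    \<open>\<bar>c\<bar> + 1\<close>, which exceeds \<open>c\<close>.\<close>
  define s where "s = (\<bar>c\<bar> + 1) / (a - b)"
  have "s > 0"
    using ab by (simp add: s_def add_nonneg_pos)
  then have "s * (a - b) \<le> c"
    using assms[of s] by (simp add: algebra_simps)
  then show False
    using ab by (simp add: s_def)
qed

text \<open>The exponents of each occurring monomial sum to at most 1, so it is the constant
  monomial or a single variable.\<close>

lemma mpoly_eval_linear: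
  fixes P :: "'v::finite int_mpoly"
  assumes "total_degree P \<le> 1"
  shows "mpoly_eval P z =
    of_int (Poly_Mapping.lookup P 0) + (\<Sum>i\<in>UNIV. of_int (linear_coeff P i) * z i)"
proof -
  let ?mon = "\<lambda>m. \<Prod>i\<in>Poly_Mapping.keys m. z i ^ Poly_Mapping.lookup m i"
  let ?x = "\<lambda>i::'v. Poly_Mapping.single i (1::nat)"
  have keys: "Poly_Mapping.keys P \<subseteq> insert 0 (range ?x)"
  proof
    fix m assume m: "m \<in> Poly_Mapping.keys P"
    have "(\<Sum>i\<in>Poly_Mapping.keys m. Poly_Mapping.lookup m i) \<le> total_degree P"
      unfolding total_degree_def using m by (intro Max_ge) auto
    with assms have le: "(\<Sum>i\<in>Poly_Mapping.keys m. Poly_Mapping.lookup m i) \<le> 1"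
      by simp
    show "m \<in> insert 0 (range ?x)"
    proof (cases "m = 0")
      case False
      then obtain i where i: "i \<in> Poly_Mapping.keys m"
        using keys_eq_empty[of m] by blast
      have "Poly_Mapping.lookup m j = Poly_Mapping.lookup (?x i) j" for j
      proof -
        have eq: "(\<Sum>k\<in>Poly_Mapping.keys m. Poly_Mapping.lookup m k) =
            Poly_Mapping.lookup m i + (\<Sum>k\<in>Poly_Mapping.keys m - {i}. Poly_Mapping.lookup m k)"
          using i by (simp add: sum.remove)
        moreover have "Poly_Mapping.lookup m i \<noteq> 0"
          using i by (simp add: in_keys_iff)
        ultimately have "Poly_Mapping.lookup m i = 1"
          and "(\<Sum>k\<in>Poly_Mapping.keys m - {i}. Poly_Mapping.lookup m k) = 0"
          using le by linarith+
        then show ?thesis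
          by (cases "j = i") (auto simp: lookup_single in_keys_iff when_def)
      qed
      then have "m = ?x i"
        by (rule poly_mapping_eqI)
      then show ?thesis
        by simp
    qed simp
  qed
  have inj: "inj ?x"
    by (rule injI) (metis keys_single one_neq_zero singleton_inject)
  have nz: "0 \<notin> range ?x"
    by (auto dest!: sym[of 0] dest: arg_cong[of _ _ Poly_Mapping.keys])
  \<comment> \<open>Candidate monomials that do not occur in \<open>P\<close> have coefficient 0, so
    the sum may run over all of them.\<close>
  have "mpoly_eval P z = (\<Sum>m\<in>insert 0 (range ?x). of_int (Poly_Mapping.lookup P m) * ?mon m)"
    unfolding mpoly_eval_def using keys by (intro sum.mono_neutral_left) (auto simp: in_keys_iff)
  also have "\<dots> = of_int (Poly_Mapping.lookup P 0) +
      (\<Sum>i\<in>UNIV. of_int (Poly_Mapping.lookup P (?x i)) * ?mon (?x i))"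
    using nz sum.reindex[OF inj, of "\<lambda>m. of_int (Poly_Mapping.lookup P m) * ?mon m"] by simp
  finally show ?thesis
    by (simp add: linear_coeff_def)
qed

section \<open>Degree counting for the GNN operator\<close>

lemma nbhd_sym: "{v. i \<in> nbhd E v} = nbhd E i"
  by (simp add: nbhd_def insert_commute)

lemma norm_vec_square:
  fixes x :: "'a::real_inner ^ 'v::finite"
  shows "(norm x)\<^sup>2 = (\<Sum>i\<in>UNIV. (norm (x $ i))\<^sup>2)"
  by (simp add: power2_norm_eq_inner inner_vec_def)

text \<open>Double counting: the entry at \<open>i\<close> enters the maximum at \<open>v\<close>
  exactly when \<open>i\<close> is a neighbour of \<open>v\<close>.\<close>

lemma norm_gnn_diff_le:
  "(norm (gnn E W g - gnn E W h))\<^sup>2 \<le>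
    (\<Sum>i\<in>UNIV. real (card (nbhd E i)) * (norm (relu (W (g $ i)) - relu (W (h $ i))))\<^sup>2)"
proof -
  let ?d = "\<lambda>i. (norm (relu (W (g $ i)) - relu (W (h $ i))))\<^sup>2"
  have "(norm (gnn E W g - gnn E W h))\<^sup>2 =
      (\<Sum>v\<in>UNIV. (norm (aggregate E W v g - aggregate E W v h))\<^sup>2)"
    by (simp add: norm_vec_square gnn_def)
  also have "\<dots> \<le> (\<Sum>v\<in>UNIV. \<Sum>i\<in>nbhd E v. ?d i)"
    unfolding aggregate_def by (intro sum_mono norm_max_L2_diff_le)
  also have "\<dots> = (\<Sum>v\<in>UNIV. \<Sum>i\<in>UNIV. if i \<in> nbhd E v then ?d i else 0)"
    by (simp add: sum.If_cases)
  also have "\<dots> = (\<Sum>i\<in>UNIV. \<Sum>v\<in>UNIV. if i \<in> nbhd E v then ?d i else 0)"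
    by (rule sum.swap)
  \<comment> \<open>Adjacency is symmetric, so the number of aggregations that read \<open>i\<close>
    is the degree of \<open>i\<close>.\<close>
  also have "\<dots> = (\<Sum>i\<in>UNIV. real (card (nbhd E i)) * ?d i)"
    by (simp add: nbhd_sym sum.If_cases)
  finally show ?thesis .
qed

text \<open>For vectors supported at \<open>i\<close>, every maximum has at most one nonzero entry,
  so the general upper bound holds with equality and the same degree factor.\<close>

lemma norm_gnn_axis_diff:
  assumes "W 0 = 0"
  shows "(norm (gnn E W (axis i x) - gnn E W (axis i y)))\<^sup>2 =
    real (card (nbhd E i)) * (norm (relu (W x) - relu (W y)))\<^sup>2"
proof -
  have agg: "aggregate E W v (axis i z) = (if i \<in> nbhd E v then relu (W z) else 0)" for v z
  proof -
    have "(\<lambda>j. relu (W (axis i z $ j))) = (\<lambda>j. if j = i then relu (W z) else 0)"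
      using assms by (auto simp: axis_def relu_zero)
    then show ?thesis
      by (simp add: aggregate_def max_L2_single_relu)
  qed
  have "(norm (gnn E W (axis i x) - gnn E W (axis i y)))\<^sup>2 =
      (\<Sum>v\<in>UNIV. if i \<in> nbhd E v then (norm (relu (W x) - relu (W y)))\<^sup>2 else 0)"
    unfolding norm_vec_square by (intro sum.cong) (auto simp: gnn_def agg)
  also have "\<dots> = real (card (nbhd E i)) * (norm (relu (W x) - relu (W y)))\<^sup>2"
    by (simp add: nbhd_sym sum.If_cases)
  finally show ?thesis .
qed

text \<open>The bound is tested on \<open>s *\<^sub>R x\<close> and \<open>s *\<^sub>R y\<close>
  placed at \<open>i\<close>. By positive homogeneity everything scales with \<open>s\<close> except
  the constant term, which drops out for large \<open>s\<close>.\<close>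

lemma norm_relu_diff_le_linear_coeff:
  assumes lin: "linear W" and deg: "total_degree P \<le> 1"
    and bound: "\<And>g h :: L2 ^ 'v::finite. norm (gnn E W g - gnn E W h)
                  \<le> L * mpoly_eval P (\<lambda>i. norm (g $ i - h $ i))"
  shows "sqrt (card (nbhd E i)) * norm (relu (W x) - relu (W y))
    \<le> L * of_int (linear_coeff P i) * norm (x - y)"
proof (rule le_of_scaled_le)
  fix s :: real
  assume s: "s > 0"
  have W0: "W 0 = 0"
    using lin by (rule linear_0)
  have "s * (sqrt (card (nbhd E i)) * norm (relu (W x) - relu (W y))) =
      sqrt (card (nbhd E i)) * norm (relu (W (s *\<^sub>R x)) - relu (W (s *\<^sub>R y)))"
    using s by (simp add: linear_scale[OF lin] relu_scaleR flip: scaleR_diff_right)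
  also have "\<dots> = norm (gnn E W (axis i (s *\<^sub>R x)) - gnn E W (axis i (s *\<^sub>R y)))"
    using norm_gnn_axis_diff[of W E i "s *\<^sub>R x" "s *\<^sub>R y", OF W0]
    by (metis norm_ge_zero real_sqrt_abs real_sqrt_mult abs_of_nonneg)
  also have "\<dots> \<le> L * mpoly_eval P (\<lambda>j. norm (axis i (s *\<^sub>R x) $ j - axis i (s *\<^sub>R y) $ j))"
    by (rule bound)
  also have "(\<lambda>j. norm (axis i (s *\<^sub>R x) $ j - axis i (s *\<^sub>R y) $ j)) =
      (\<lambda>j. if j = i then s * norm (x - y) else 0)"
    using s by (auto simp: axis_def simp flip: scaleR_diff_right)
  also have "L * mpoly_eval P (\<lambda>j. if j = i then s * norm (x - y) else 0) =
      L * of_int (Poly_Mapping.lookup P 0) + s * (L * of_int (linear_coeff P i) * norm (x - y))"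
    by (simp add: mpoly_eval_linear[OF deg] if_distrib[of "(*) _"] distrib_left mult_ac cong: if_cong)
  finally show "s * (sqrt (card (nbhd E i)) * norm (relu (W x) - relu (W y)))
    \<le> L * of_int (Poly_Mapping.lookup P 0) + s * (L * of_int (linear_coeff P i) * norm (x - y))" .
qed

text \<open>The degree in the upper estimate goes inside the square as its root, where the bound at
  each vertex absorbs it. The common constant then factors out of the sum of squares.\<close>

lemma norm_gnn_diff_le_Max_linear_coeff:
  assumes lin: "linear W" and deg: "total_degree P \<le> 1" and L: "L \<ge> 0"
    and nonneg: "\<And>m. Poly_Mapping.lookup P m \<ge> 0"
    and bound: "\<And>g h :: L2 ^ 'v::finite. norm (gnn E W g - gnn E W h)
                  \<le> L * mpoly_eval P (\<lambda>i. norm (g $ i - h $ i))"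
  shows "norm (gnn E W g - gnn E W h) \<le> L * of_int (Max (range (linear_coeff P))) * norm (g - h)"
proof (rule power2_le_imp_le)
  let ?a = "linear_coeff P" and ?A = "Max (range (linear_coeff P))"
  have a: "0 \<le> ?a i" "?a i \<le> ?A" for i
    using nonneg by (auto simp: linear_coeff_def intro: Max_ge)
  then have A: "0 \<le> ?A"
    by (meson order_trans)
  then show "0 \<le> L * of_int ?A * norm (g - h)"
    using L by simp
  have "(norm (gnn E W g - gnn E W h))\<^sup>2 \<le>
      (\<Sum>i\<in>UNIV. (sqrt (card (nbhd E i)) * norm (relu (W (g $ i)) - relu (W (h $ i))))\<^sup>2)"
    using norm_gnn_diff_le[of E W g h] by (simp add: power_mult_distrib)
  also have "\<dots> \<le> (\<Sum>i\<in>UNIV. (L * of_int ?A * norm (g $ i - h $ i))\<^sup>2)"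
  proof (intro sum_mono power_mono)
    fix i
    have "sqrt (card (nbhd E i)) * norm (relu (W (g $ i)) - relu (W (h $ i)))
        \<le> L * of_int (?a i) * norm (g $ i - h $ i)"
      using lin deg bound by (rule norm_relu_diff_le_linear_coeff)
    also have "\<dots> \<le> L * of_int ?A * norm (g $ i - h $ i)"
      using L a by (intro mult_right_mono mult_left_mono) auto
    finally show "sqrt (card (nbhd E i)) * norm (relu (W (g $ i)) - relu (W (h $ i)))
        \<le> L * of_int ?A * norm (g $ i - h $ i)" .
  qed simp
  also have "\<dots> = (L * of_int ?A * norm (g - h))\<^sup>2"
    by (simp only: norm_vec_square power_mult_distrib sum_distrib_left vector_minus_component)
  finally show "(norm (gnn E W g - gnn E W h))\<^sup>2 \<le> (L * of_int ?A * norm (g - h))\<^sup>2" .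
qed

section \<open>Fixed point iteration\<close>

text \<open>Each application shrinks the distance to the fixed point by the factor \<open>c\<close>,
  so the error decays geometrically from any starting point.\<close>

lemma contraction_iterates_tendsto:
  fixes F :: "'a::metric_space \<Rightarrow> 'a"
  assumes c: "0 \<le> c" "c < 1" and lip: "\<And>x y. dist (F x) (F y) \<le> c * dist x y" and y: "F y = y"
  shows "(\<lambda>n. (F ^^ n) x) \<longlonglongrightarrow> y"
proof -
  have le: "dist ((F ^^ n) x) y \<le> c ^ n * dist x y" for n
  proof (induction n)
    case (Suc n)
    have "dist ((F ^^ Suc n) x) y \<le> c * dist ((F ^^ n) x) y"
      using lip[of "(F ^^ n) x" y] y by simp
    also have "\<dots> \<le> c * (c ^ n * dist x y)"
      using Suc.IH c by (intro mult_left_mono)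
    finally show ?case
      by (simp add: mult.assoc)
  qed simp
  have "(\<lambda>n. c ^ n * dist x y) \<longlonglongrightarrow> 0"
    using c by (intro tendsto_mult_left_zero LIMSEQ_realpow_zero)
  then have "(\<lambda>n. dist ((F ^^ n) x) y) \<longlonglongrightarrow> 0"
    by (rule Lim_null_comparison[rotated]) (simp add: le)
  then show ?thesis
    by (subst tendsto_dist_iff)
qed

theorem theorem4:
  fixes E :: "'v::finite set set"
    and W :: "L2 \<Rightarrow> L2"
    and L :: real
    and P :: "'v int_mpoly"
    and f :: "L2 ^ 'v"
  assumes graph: "is_graph E"
    and linear: "linear W"
    and lipschitz: "L-lipschitz_on UNIV W"
    and degree: "total_degree P = 1"
    and nonneg: "\<forall>m. Poly_Mapping.lookup P m \<ge> 0"
    and bound: "\<forall>g h :: L2 ^ 'v. norm (gnn E W g - gnn E W h)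
                  \<le> L * mpoly_eval P (\<lambda>i. norm (g $ i - h $ i))"
    and small: "L * real_of_int (Max (range (linear_coeff P))) < 1"
  shows "(\<exists>!y. gnn E W y + f = y) \<and>
         (\<forall>y. gnn E W y + f = y \<longrightarrow> (\<lambda>n. ((\<lambda>x. gnn E W x + f) ^^ n) f) \<longlonglongrightarrow> y)"
proof -
  let ?F = "\<lambda>x. gnn E W x + f" and ?c = "L * real_of_int (Max (range (linear_coeff P)))"
  have L: "L \<ge> 0"
    using lipschitz by (rule lipschitz_on_nonneg)
  \<comment> \<open>\<open>undefined\<close> serves as an arbitrary vertex; one nonnegative
    coefficient makes the maximum nonnegative.\<close>
  have "0 \<le> linear_coeff P undefined"
    using nonneg by (simp add: linear_coeff_def)
  also have "\<dots> \<le> Max (range (linear_coeff P))"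
    by (intro Max_ge) auto
  finally have c: "0 \<le> ?c"
    using L by simp
  \<comment> \<open>Adding \<open>f\<close> is a translation and cancels in the distance.\<close>
  have lip: "dist (?F x) (?F y) \<le> ?c * dist x y" for x y
    using norm_gnn_diff_le_Max_linear_coeff[OF linear _ L, of P E x y] degree nonneg bound
    by (simp add: dist_norm)
  \<comment> \<open>Completeness of \<open>L2 ^ 'v\<close> is inherited from the instance for
    \<open>L2\<close>.\<close>
  have "\<exists>!y. ?F y = y"
    using c small lip by (intro banach_fix_type) auto
  moreover have "(\<lambda>n. (?F ^^ n) f) \<longlonglongrightarrow> y" if "?F y = y" for y
    using c small lip that by (rule contraction_iterates_tendsto)
  ultimately show ?thesis
    by blast
qed

end
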